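(* Let $q\in Y$ be such that $q_{xxyy}=q_{yyxx}\in C(\Omega)$, and let $z\in\mathbb{C}$ be such that $z\ne-\alpha$ and $k(z)\neq0$. Then $$\Delta(z)q=0\iff\bigl\{L(z)\Delta(z)q=0\ \text{ and }\ K(z)L(z)q=L(z)K(z)q\bigr\}.$$ Moreover, for any $g\in Y$, $$\Delta(z)q=K(z)g\iff\bigl\{L(z)\Delta(z)q=4c(z)k^2(z)g\ \text{ and }\ K(z)L(z)q=L(z)K(z)q\bigr\}.$$
   Context: Fix $a,b>0$, $\bar\Omega=[-a,a]\times[-b,b]$ with interior $\Omega$, and write $r=(x,y)\in\bar\Omega$, $\|r\|_1=|x|+|y|$. Let $Y=C(\bar\Omega)$ be the space of continuous complex-valued functions on $\bar\Omega$. Fix reals $\alpha>0$, $\tau_0>0$, $S'(0)\ne0$ and complex numbers $\hat c\ne0$, $\xi$ such that $J(r,r')=\hat ce^{-\xi\|r-r'\|_1}$ is real-valued. For $z\in\mathbb{C}$ put $k(z)=z+\xi$, $c(z)=\hat cS'(0)e^{-\tau_0z}$ (so $c(z)\ne0$), and $$(K(z)q)(r)=c(z)\int_\Omega e^{-k(z)\|r-r'\|_1}q(r')\,dr',\qquad\Delta(z)q=(z+\alpha)q-K(z)q,$$ $$L(z)q=\Bigl(k^2(z)-\frac{\partial^2}{\partial x^2}\Bigr)\Bigl(k^2(z)-\frac{\partial^2}{\partial y^2}\Bigr)q .$$ The condition $q_{xxyy}=q_{yyxx}\in C(\Omega)$ is the smoothness condition under which $L(z)q$ is regarded as well defined. 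*)

theory Defs
  imports "HOL-Analysis.Analysis"
begin

definition Omega :: "real \<Rightarrow> real \<Rightarrow> (real \<times> real) set" where
  "Omega a b = {-a<..<a} \<times> {-b<..<b}"

definition Omega_bar :: "real \<Rightarrow> real \<Rightarrow> (real \<times> real) set" where
  "Omega_bar a b = {-a..a} \<times> {-b..b}"

text \<open>An element of \<open>C(Omega_bar)\<close> is represented by a total function on the plane;
  its values outside \<open>Omega_bar\<close> are irrelevant, and equalities are only
  ever stated on \<open>Omega_bar\<close> or \<open>Omega\<close>.\<close>

definition Y :: "real \<Rightarrow> real \<Rightarrow> (real \<times> real \<Rightarrow> complex) set" where
  "Y a b = {q. continuous_on (Omega_bar a b) q}"

definition l1norm :: "real \<times> real \<Rightarrow> real" where
  "l1norm r = \<bar>fst r\<bar> + \<bar>snd r\<bar>"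

definition J :: "complex \<Rightarrow> complex \<Rightarrow> real \<times> real \<Rightarrow> real \<times> real \<Rightarrow> complex" where
  "J chat \<xi> r r' = chat * exp (- \<xi> * complex_of_real (l1norm (r - r')))"

definition k_coeff :: "complex \<Rightarrow> complex \<Rightarrow> complex" where
  "k_coeff \<xi> z = z + \<xi>"

text \<open>The real number \<open>S1\<close> is \<open>S'(0)\<close>.\<close>

definition c_coeff :: "complex \<Rightarrow> real \<Rightarrow> real \<Rightarrow> complex \<Rightarrow> complex" where
  "c_coeff chat S1 \<tau>0 z = chat * complex_of_real S1 * exp (- complex_of_real \<tau>0 * z)"

text \<open>In the operators below, \<open>k\<close> and \<open>c\<close> stand for the values
  \<open>k(z)\<close> and \<open>c(z)\<close>. The Bochner integral in \<open>K_op\<close> is \<open>0\<close> for non-integrable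
  integrands. It is also applied to \<open>L_op k q\<close>, which need not be integrable for general \<open>q\<close>;
  but if \<open>L (\<Delta> q) = 4 c k\<^sup>2 g\<close> on \<open>Omega\<close> with \<open>g\<close> continuous on \<open>Omega_bar\<close>, then
  \<open>(z + \<alpha>) L q = 4 c k\<^sup>2 (q + g)\<close> on \<open>Omega\<close>, so \<open>L q\<close> is bounded and continuous there.\<close>

definition K_op ::
  "real \<Rightarrow> real \<Rightarrow> complex \<Rightarrow> complex \<Rightarrow> (real \<times> real \<Rightarrow> complex) \<Rightarrow> real \<times> real \<Rightarrow> complex" where
  "K_op a b k c q r =
     c * (LINT r':Omega a b|lborel. exp (- k * complex_of_real (l1norm (r - r'))) * q r')"

definition Delta_op ::
  "real \<Rightarrow> real \<Rightarrow> complex \<Rightarrow> complex \<Rightarrow> real \<Rightarrow> complex \<Rightarrow>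
    (real \<times> real \<Rightarrow> complex) \<Rightarrow> real \<times> real \<Rightarrow> complex" where
  "Delta_op a b k c \<alpha> z q r = (z + complex_of_real \<alpha>) * q r - K_op a b k c q r"

definition dx :: "(real \<times> real \<Rightarrow> complex) \<Rightarrow> real \<times> real \<Rightarrow> complex" where
  "dx f r = vector_derivative (\<lambda>t. f (t, snd r)) (at (fst r))"

definition dy :: "(real \<times> real \<Rightarrow> complex) \<Rightarrow> real \<times> real \<Rightarrow> complex" where
  "dy f r = vector_derivative (\<lambda>t. f (fst r, t)) (at (snd r))"

definition x_differentiable_on :: "(real \<times> real \<Rightarrow> complex) \<Rightarrow> (real \<times> real) set \<Rightarrow> bool" where
  "x_differentiable_on f U \<longleftrightarrow> (\<forall>r\<in>U. (\<lambda>t. f (t, snd r)) differentiable at (fst r))"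

definition y_differentiable_on :: "(real \<times> real \<Rightarrow> complex) \<Rightarrow> (real \<times> real) set \<Rightarrow> bool" where
  "y_differentiable_on f U \<longleftrightarrow> (\<forall>r\<in>U. (\<lambda>t. f (fst r, t)) differentiable at (snd r))"

text \<open>The condition \<open>q_xxyy = q_yyxx \<in> C(U)\<close>. The functions \<open>dx f\<close> and \<open>dy f\<close> are
  total, so existence of every intermediate partial derivative is required explicitly.
  No continuity of the intermediate derivatives is assumed.\<close>

definition mixed_smooth_on :: "(real \<times> real \<Rightarrow> complex) \<Rightarrow> (real \<times> real) set \<Rightarrow> bool" where
  "mixed_smooth_on q U \<longleftrightarrow>
     x_differentiable_on q U \<and> x_differentiable_on (dx q) U \<and>
     y_differentiable_on (dx (dx q)) U \<and> y_differentiable_on (dy (dx (dx q))) U \<and>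
     y_differentiable_on q U \<and> y_differentiable_on (dy q) U \<and>
     x_differentiable_on (dy (dy q)) U \<and> x_differentiable_on (dx (dy (dy q))) U \<and>
     (\<forall>r\<in>U. dy (dy (dx (dx q))) r = dx (dx (dy (dy q))) r) \<and>
     continuous_on U (dy (dy (dx (dx q))))"

definition L_op :: "complex \<Rightarrow> (real \<times> real \<Rightarrow> complex) \<Rightarrow> real \<times> real \<Rightarrow> complex" where
  "L_op k q =
     (let p = (\<lambda>r. k\<^sup>2 * q r - dy (dy q) r) in (\<lambda>r. k\<^sup>2 * p r - dx (dx p) r))"

end

theory Submission
  imports Defs
begin

text \<open>
  The kernel \<open>exp (- k * l1norm (r - r'))\<close> is the product of two one-dimensional kernels
  \<open>exp (- k * \<bar>s - t\<bar>)\<close>, and each of these is \<open>2 * k\<close> times a fundamental solution of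
  \<open>k\<^sup>2 - d\<^sup>2/ds\<^sup>2\<close> (lemma \<open>exp_conv_deriv_has_deriv\<close>).  By Fubini, \<open>L\<close> is
  therefore a left inverse of \<open>K\<close> up to a factor: \<open>L K u = 4 c k\<^sup>2 u\<close> on the open rectangle for
  every \<open>u\<close> continuous on the closed one (lemma \<open>has_L_on_K_op\<close>).

  Put \<open>m = z + \<alpha> \<noteq> 0\<close> and \<open>u = g + q\<close>.  The equation \<open>\<Delta> q = K g\<close> says \<open>m q = K u\<close>, and
  \<open>L \<Delta> q = 4 c k\<^sup>2 g\<close> says \<open>m L q = 4 c k\<^sup>2 u\<close>, because \<open>L K q = 4 c k\<^sup>2 q\<close>.  If \<open>m q = K u\<close>, then
  applying \<open>L\<close> gives \<open>m L q = 4 c k\<^sup>2 u\<close>; applying \<open>K\<close> to that gives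
  \<open>m K L q = 4 c k\<^sup>2 K u = 4 c k\<^sup>2 m q\<close>, that is \<open>K L q = L K q\<close>.  Conversely, applying \<open>K\<close> to
  \<open>m L q = 4 c k\<^sup>2 u\<close> and using \<open>K L q = L K q = 4 c k\<^sup>2 q\<close> gives \<open>m q = K u\<close> on the open rectangle,
  and by continuity on the closed one.  This is lemma \<open>K_op_eq_iff\<close>; the homogeneous equivalence
  is the case \<open>g = 0\<close>.
\<close>

section \<open>Partial derivatives and the differential operator\<close>

definition has_dx_on ::
  "(real \<times> real \<Rightarrow> complex) \<Rightarrow> (real \<times> real \<Rightarrow> complex) \<Rightarrow> (real \<times> real) set \<Rightarrow> bool" where
  "has_dx_on f f' U \<longleftrightarrow>
     (\<forall>r\<in>U. ((\<lambda>t. f (t, snd r)) has_vector_derivative f' r) (at (fst r)))"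

definition has_dy_on ::
  "(real \<times> real \<Rightarrow> complex) \<Rightarrow> (real \<times> real \<Rightarrow> complex) \<Rightarrow> (real \<times> real) set \<Rightarrow> bool" where
  "has_dy_on f f' U \<longleftrightarrow>
     (\<forall>r\<in>U. ((\<lambda>t. f (fst r, t)) has_vector_derivative f' r) (at (snd r)))"

lemma has_dx_on_cong:
  assumes "open U" "has_dx_on f f' U" "\<And>r. r \<in> U \<Longrightarrow> f r = g r" "\<And>r. r \<in> U \<Longrightarrow> f' r = g' r"
  shows "has_dx_on g g' U"
  unfolding has_dx_on_def
proof
  fix r assume r: "r \<in> U"
  let ?S = "(\<lambda>t. (t, snd r)) -` U"
  have S: "open ?S"
    by (intro continuous_open_vimage assms(1)) (intro continuous_intros)
  have "((\<lambda>t. f (t, snd r)) has_vector_derivative g' r) (at (fst r))"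
    using assms(2) assms(4)[OF r, symmetric] r by (simp add: has_dx_on_def)
  then show "((\<lambda>t. g (t, snd r)) has_vector_derivative g' r) (at (fst r))"
    by (rule has_vector_derivative_transform_within_open[OF _ S]) (use r assms(3) in auto)
qed

lemma has_dy_on_cong:
  assumes "open U" "has_dy_on f f' U" "\<And>r. r \<in> U \<Longrightarrow> f r = g r" "\<And>r. r \<in> U \<Longrightarrow> f' r = g' r"
  shows "has_dy_on g g' U"
  unfolding has_dy_on_def
proof
  fix r assume r: "r \<in> U"
  let ?S = "(\<lambda>t. (fst r, t)) -` U"
  have S: "open ?S"
    by (intro continuous_open_vimage assms(1)) (intro continuous_intros)
  have "((\<lambda>t. f (fst r, t)) has_vector_derivative g' r) (at (snd r))"
    using assms(2) assms(4)[OF r, symmetric] r by (simp add: has_dy_on_def)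
  then show "((\<lambda>t. g (fst r, t)) has_vector_derivative g' r) (at (snd r))"
    by (rule has_vector_derivative_transform_within_open[OF _ S]) (use r assms(3) in auto)
qed

lemma has_dx_on_lincomb:
  assumes "has_dx_on f f' U" "has_dx_on g g' U"
  shows "has_dx_on (\<lambda>r. s * f r - t * g r) (\<lambda>r. s * f' r - t * g' r) U"
  using assms unfolding has_dx_on_def
  by (auto intro!: has_vector_derivative_diff has_vector_derivative_mult_right)

lemma has_dy_on_lincomb:
  assumes "has_dy_on f f' U" "has_dy_on g g' U"
  shows "has_dy_on (\<lambda>r. s * f r - t * g r) (\<lambda>r. s * f' r - t * g' r) U"
  using assms unfolding has_dy_on_def
  by (auto intro!: has_vector_derivative_diff has_vector_derivative_mult_right)

lemma dx_eqI: "has_dx_on f f' U \<Longrightarrow> r \<in> U \<Longrightarrow> dx f r = f' r"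
  by (auto simp: has_dx_on_def dx_def intro: vector_derivative_at)

lemma dy_eqI: "has_dy_on f f' U \<Longrightarrow> r \<in> U \<Longrightarrow> dy f r = f' r"
  by (auto simp: has_dy_on_def dy_def intro: vector_derivative_at)

lemma has_dx_on_dx: "x_differentiable_on f U \<Longrightarrow> has_dx_on f (dx f) U"
  by (auto simp: has_dx_on_def x_differentiable_on_def dx_def vector_derivative_works)

lemma has_dy_on_dy: "y_differentiable_on f U \<Longrightarrow> has_dy_on f (dy f) U"
  by (auto simp: has_dy_on_def y_differentiable_on_def dy_def vector_derivative_works)

text \<open>
  The operator \<open>L_op\<close> is built from total derivative functions, which have arbitrary values where
  the derivatives do not exist, so it is not linear.  The relation below adds that all derivatives
  entering \<open>L f\<close> exist on \<open>U\<close>, taken in the order of \<open>L_op\<close>; it can be combined linearly, and on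
  an open set it depends only on the values there.
\<close>

definition has_L_on ::
  "complex \<Rightarrow> (real \<times> real \<Rightarrow> complex) \<Rightarrow> (real \<times> real \<Rightarrow> complex) \<Rightarrow> (real \<times> real) set \<Rightarrow> bool" where
  "has_L_on k f h U \<longleftrightarrow>
     (\<exists>f1 f2 p p1 p2. has_dy_on f f1 U \<and> has_dy_on f1 f2 U \<and>
        p = (\<lambda>r. k\<^sup>2 * f r - f2 r) \<and> has_dx_on p p1 U \<and> has_dx_on p1 p2 U \<and>
        (\<forall>r\<in>U. h r = k\<^sup>2 * p r - p2 r))"

lemma has_L_onI:
  assumes "has_dy_on f f1 U" "has_dy_on f1 f2 U" "p = (\<lambda>r. k\<^sup>2 * f r - f2 r)"
    and "has_dx_on p p1 U" "has_dx_on p1 p2 U" "\<forall>r\<in>U. h r = k\<^sup>2 * p r - p2 r"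
  shows "has_L_on k f h U"
  unfolding has_L_on_def using assms by (intro exI conjI)

lemma has_L_on_L_op_eq:
  assumes U: "open U" and L: "has_L_on k f h U" and r: "r \<in> U"
  shows "L_op k f r = h r"
proof -
  obtain f1 f2 p p1 p2 where
    d: "has_dy_on f f1 U" "has_dy_on f1 f2 U" "has_dx_on p p1 U" "has_dx_on p1 p2 U"
    and p: "p = (\<lambda>r. k\<^sup>2 * f r - f2 r)" and h: "\<forall>r\<in>U. h r = k\<^sup>2 * p r - p2 r"
    using L unfolding has_L_on_def by blast
  define P where "P = (\<lambda>r. k\<^sup>2 * f r - dy (dy f) r)"
  have "has_dy_on (dy f) f2 U"
    by (rule has_dy_on_cong[OF U d(2)]) (simp_all add: dy_eqI[OF d(1)])
  then have pP: "p s = P s" if "s \<in> U" for s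
    using that by (simp add: p P_def dy_eqI)
  have 1: "has_dx_on P p1 U"
    by (rule has_dx_on_cong[OF U d(3)]) (simp_all add: pP)
  have "has_dx_on (dx P) p2 U"
    by (rule has_dx_on_cong[OF U d(4)]) (simp_all add: dx_eqI[OF 1])
  then have "dx (dx P) r = p2 r"
    using r by (rule dx_eqI)
  then show ?thesis
    using h r pP[OF r] by (simp add: L_op_def P_def Let_def)
qed

lemma has_L_on_cong:
  assumes U: "open U" and L: "has_L_on k f h U"
    and eq: "\<And>r. r \<in> U \<Longrightarrow> f r = g r" "\<And>r. r \<in> U \<Longrightarrow> h r = i r"
  shows "has_L_on k g i U"
proof -
  obtain f1 f2 p p1 p2 where
    d: "has_dy_on f f1 U" "has_dy_on f1 f2 U" "has_dx_on p p1 U" "has_dx_on p1 p2 U"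
    and p: "p = (\<lambda>r. k\<^sup>2 * f r - f2 r)" and h: "\<forall>r\<in>U. h r = k\<^sup>2 * p r - p2 r"
    using L unfolding has_L_on_def by blast
  have "has_dy_on g f1 U"
    by (rule has_dy_on_cong[OF U d(1)]) (simp_all add: eq)
  moreover have "has_dx_on (\<lambda>r. k\<^sup>2 * g r - f2 r) p1 U"
    by (rule has_dx_on_cong[OF U d(3)]) (simp_all add: eq p)
  moreover have "\<forall>r\<in>U. i r = k\<^sup>2 * (k\<^sup>2 * g r - f2 r) - p2 r"
    using h eq by (simp add: p)
  ultimately show ?thesis
    using d by (intro has_L_onI[OF _ _ refl])
qed

lemma has_L_on_lincomb:
  assumes "has_L_on k f h U" "has_L_on k f' h' U"
  shows "has_L_on k (\<lambda>r. s * f r - t * f' r) (\<lambda>r. s * h r - t * h' r) U"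
proof -
  obtain f1 f2 p p1 p2 where
    d: "has_dy_on f f1 U" "has_dy_on f1 f2 U" "has_dx_on p p1 U" "has_dx_on p1 p2 U"
    and p: "p = (\<lambda>r. k\<^sup>2 * f r - f2 r)" and h: "\<forall>r\<in>U. h r = k\<^sup>2 * p r - p2 r"
    using assms(1) unfolding has_L_on_def by blast
  obtain f1' f2' p' p1' p2' where
    d': "has_dy_on f' f1' U" "has_dy_on f1' f2' U" "has_dx_on p' p1' U" "has_dx_on p1' p2' U"
    and p': "p' = (\<lambda>r. k\<^sup>2 * f' r - f2' r)" and h': "\<forall>r\<in>U. h' r = k\<^sup>2 * p' r - p2' r"
    using assms(2) unfolding has_L_on_def by blast
  have P: "(\<lambda>r. s * p r - t * p' r) =
      (\<lambda>r. k\<^sup>2 * (s * f r - t * f' r) - (s * f2 r - t * f2' r))"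
    by (simp add: p p' algebra_simps)
  have "\<forall>r\<in>U. s * h r - t * h' r =
      k\<^sup>2 * (s * p r - t * p' r) - (s * p2 r - t * p2' r)"
    using h h' by (simp add: right_diff_distrib)
  then show ?thesis
    by (rule has_L_onI[OF has_dy_on_lincomb[OF d(1) d'(1)] has_dy_on_lincomb[OF d(2) d'(2)] P
          has_dx_on_lincomb[OF d(3) d'(3)] has_dx_on_lincomb[OF d(4) d'(4)]])
qed

lemma has_L_on_L_op:
  assumes U: "open U" and q: "mixed_smooth_on q U"
  shows "has_L_on k q (L_op k q) U"
proof -
  have d: "has_dx_on q (dx q) U" "has_dx_on (dx q) (dx (dx q)) U"
    "has_dy_on q (dy q) U" "has_dy_on (dy q) (dy (dy q)) U"
    "has_dx_on (dy (dy q)) (dx (dy (dy q))) U"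
    "has_dx_on (dx (dy (dy q))) (dx (dx (dy (dy q)))) U"
    using q unfolding mixed_smooth_on_def by (auto intro: has_dx_on_dx has_dy_on_dy)
  let ?p = "\<lambda>r. k\<^sup>2 * q r - dy (dy q) r"
  let ?p1 = "\<lambda>r. k\<^sup>2 * dx q r - dx (dy (dy q)) r"
  let ?p2 = "\<lambda>r. k\<^sup>2 * dx (dx q) r - dx (dx (dy (dy q))) r"
  have 1: "has_dx_on ?p ?p1 U"
    using has_dx_on_lincomb[OF d(1,5), of "k\<^sup>2" 1] by simp
  then have p1: "?p1 r = dx ?p r" if "r \<in> U" for r
    using that by (simp add: dx_eqI)
  have 2: "has_dx_on ?p1 ?p2 U"
    using has_dx_on_lincomb[OF d(2,6), of "k\<^sup>2" 1] by simp
  have "has_dx_on (dx ?p) ?p2 U"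
    by (rule has_dx_on_cong[OF U 2]) (simp_all add: p1)
  then have "\<forall>r\<in>U. L_op k q r = k\<^sup>2 * ?p r - ?p2 r"
    by (simp add: L_op_def Let_def dx_eqI)
  then show ?thesis
    using d(3,4) 1 2 by (intro has_L_onI[OF _ _ refl])
qed


section \<open>The one-dimensional exponential kernel\<close>

definition exp_conv :: "complex \<Rightarrow> real \<Rightarrow> real \<Rightarrow> (real \<Rightarrow> complex) \<Rightarrow> real \<Rightarrow> complex" where
  "exp_conv k l u h y = integral {l..u} (\<lambda>t. exp (- k * of_real \<bar>y - t\<bar>) * h t)"

definition exp_conv_deriv :: "complex \<Rightarrow> real \<Rightarrow> real \<Rightarrow> (real \<Rightarrow> complex) \<Rightarrow> real \<Rightarrow> complex" where
  "exp_conv_deriv k l u h y =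
     k * (exp (k * of_real y) * integral {y..u} (\<lambda>t. exp (- k * of_real t) * h t)
        - exp (- k * of_real y) * integral {l..y} (\<lambda>t. exp (k * of_real t) * h t))"

text \<open>
  Cutting the interval at the kink of the kernel turns the convolution into a combination of
  functions that the product rule and the fundamental theorem of calculus can differentiate.
\<close>

lemma exp_conv_split:
  assumes h: "continuous_on {l..u} h" and y: "y \<in> {l..u}"
  shows "exp_conv k l u h y =
      exp (- k * of_real y) * integral {l..y} (\<lambda>t. exp (k * of_real t) * h t)
    + exp (k * of_real y) * integral {y..u} (\<lambda>t. exp (- k * of_real t) * h t)"
proof -
  have "(\<lambda>t. exp (- k * of_real \<bar>y - t\<bar>) * h t) integrable_on {l..u}"
    by (intro integrable_continuous_real continuous_intros h)
  then have "exp_conv k l u h y =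
      integral {l..y} (\<lambda>t. exp (- k * of_real \<bar>y - t\<bar>) * h t)
    + integral {y..u} (\<lambda>t. exp (- k * of_real \<bar>y - t\<bar>) * h t)"
    unfolding exp_conv_def
    using y by (intro Henstock_Kurzweil_Integration.integral_combine[symmetric]) auto
  also have "integral {l..y} (\<lambda>t. exp (- k * of_real \<bar>y - t\<bar>) * h t) =
      integral {l..y} (\<lambda>t. exp (- k * of_real y) * (exp (k * of_real t) * h t))"
    by (intro integral_cong) (simp add: exp_add[symmetric] algebra_simps flip: mult.assoc)
  also have "integral {y..u} (\<lambda>t. exp (- k * of_real \<bar>y - t\<bar>) * h t) =
      integral {y..u} (\<lambda>t. exp (k * of_real y) * (exp (- k * of_real t) * h t))"
    by (intro integral_cong) (simp add: exp_add[symmetric] algebra_simps flip: mult.assoc)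
  finally show ?thesis
    by simp
qed

lemma exp_of_real_has_vector_derivative:
  "((\<lambda>t. exp (k * complex_of_real t)) has_vector_derivative k * exp (k * of_real y)) (at y)"
  by (rule has_vector_derivative_real_field[where f = "\<lambda>w. exp (k * w)"])
     (auto intro!: derivative_eq_intros)

lemma exp_weighted_integral_derivs:
  fixes h :: "real \<Rightarrow> complex"
  assumes h: "continuous_on {l..u} h" and y: "y \<in> {l<..<u}"
  shows "((\<lambda>v. exp (- k * of_real v) * integral {l..v} (\<lambda>t. exp (k * of_real t) * h t))
           has_vector_derivative
         h y - k * (exp (- k * of_real y) * integral {l..y} (\<lambda>t. exp (k * of_real t) * h t)))
         (at y)" (is ?A)
    and "((\<lambda>v. exp (k * of_real v) * integral {v..u} (\<lambda>t. exp (- k * of_real t) * h t))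
           has_vector_derivative
         k * (exp (k * of_real y) * integral {y..u} (\<lambda>t. exp (- k * of_real t) * h t)) - h y)
         (at y)" (is ?B)
proof -
  have at: "at y within {l..u} = at y"
    using y by (intro at_within_interior) simp
  have "((\<lambda>v. integral {l..v} (\<lambda>t. exp (k * of_real t) * h t)) has_vector_derivative
      exp (k * of_real y) * h y) (at y within {l..u})"
    by (rule integral_has_vector_derivative) (use y in \<open>auto intro!: continuous_intros h\<close>)
  then have 1: "((\<lambda>v. integral {l..v} (\<lambda>t. exp (k * of_real t) * h t)) has_vector_derivative
      exp (k * of_real y) * h y) (at y)"
    by (simp only: at)
  have "((\<lambda>v. integral {v..u} (\<lambda>t. exp (- k * of_real t) * h t)) has_vector_derivative
      - (exp (- k * of_real y) * h y)) (at y within {l..u})"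
    by (rule integral_has_vector_derivative') (use y in \<open>auto intro!: continuous_intros h\<close>)
  then have 2: "((\<lambda>v. integral {v..u} (\<lambda>t. exp (- k * of_real t) * h t)) has_vector_derivative
      - (exp (- k * of_real y) * h y)) (at y)"
    by (simp only: at)
  have ea: "exp (- k * of_real y) * (exp (k * of_real y) * h y) = h y"
    by (simp flip: mult.assoc exp_add)
  have eb: "exp (k * of_real y) * (exp (- k * of_real y) * h y) = h y"
    by (simp flip: mult.assoc exp_add)
  show ?A
    using has_vector_derivative_mult[OF exp_of_real_has_vector_derivative[of "- k"] 1]
    by (simp only: ea) (simp add: mult.assoc)
  show ?B
    using has_vector_derivative_mult[OF exp_of_real_has_vector_derivative[of k] 2]
    by (simp only: mult_minus_right eb) (simp add: mult.assoc)
qed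

lemma exp_conv_has_deriv:
  assumes h: "continuous_on {l..u} h" and y: "y \<in> {l<..<u}"
  shows "(exp_conv k l u h has_vector_derivative exp_conv_deriv k l u h y) (at y)"
proof (rule has_vector_derivative_transform_within_open[where S = "{l<..<u}"])
  show "((\<lambda>v. exp (- k * of_real v) * integral {l..v} (\<lambda>t. exp (k * of_real t) * h t)
      + exp (k * of_real v) * integral {v..u} (\<lambda>t. exp (- k * of_real t) * h t))
      has_vector_derivative exp_conv_deriv k l u h y) (at y)"
    by (rule has_vector_derivative_eq_rhs
          [OF has_vector_derivative_add[OF exp_weighted_integral_derivs[OF h y]]])
       (simp add: exp_conv_deriv_def algebra_simps)
qed (use y in \<open>auto simp: exp_conv_split[OF h]\<close>)

text \<open>
  Green's function of \<open>k\<^sup>2 - d\<^sup>2/dy\<^sup>2\<close>: the kernel has slope jump \<open>- 2 * k\<close> at its kink.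
\<close>

lemma exp_conv_deriv_has_deriv:
  assumes h: "continuous_on {l..u} h" and y: "y \<in> {l<..<u}"
  shows "(exp_conv_deriv k l u h has_vector_derivative
           k\<^sup>2 * exp_conv k l u h y - 2 * k * h y) (at y)"
proof -
  have "y \<in> {l..u}"
    using y by simp
  note split = exp_conv_split[OF h this]
  show ?thesis
    unfolding exp_conv_deriv_def
    by (rule has_vector_derivative_eq_rhs
          [OF has_vector_derivative_mult_right
            [OF has_vector_derivative_diff
              [OF exp_weighted_integral_derivs(2,1)[OF h y]]]])
       (simp add: split algebra_simps power2_eq_square)
qed

section \<open>The integral operator\<close>

lemma Omega_eq_box: "Omega a b = box (-a, -b) (a, b)"
  by (auto simp: Omega_def box_prod)

lemma Omega_bar_eq_cbox: "Omega_bar a b = cbox (-a, -b) (a, b)"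
  by (auto simp: Omega_bar_def cbox_prod)

lemma Omega_subset: "Omega a b \<subseteq> Omega_bar a b"
  by (auto simp: Omega_def Omega_bar_def)

lemma open_Omega: "open (Omega a b)"
  by (simp add: Omega_eq_box open_box)

lemma closure_Omega: "a > 0 \<Longrightarrow> b > 0 \<Longrightarrow> closure (Omega a b) = Omega_bar a b"
  by (simp add: Omega_def Omega_bar_def closure_Times)

lemma set_integrable_Omega:
  fixes f :: "real \<times> real \<Rightarrow> complex"
  assumes "continuous_on (Omega_bar a b) f"
  shows "set_integrable lborel (Omega a b) f"
proof (rule set_integrable_subset[where A = "Omega_bar a b"])
  show "set_integrable lborel (Omega_bar a b) f"
    unfolding set_integrable_def using assms
    by (intro borel_integrable_compact) (simp_all add: Omega_bar_eq_cbox)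
qed (simp_all add: Omega_subset, simp add: Omega_eq_box)

lemma continuous_on_Y_compose:
  assumes "f \<in> Y a b" "continuous_on A g" "g ` A \<subseteq> Omega_bar a b"
  shows "continuous_on A (\<lambda>x. f (g x))"
  using assms unfolding Y_def by (auto intro: continuous_on_compose2)

lemma continuous_on_kernel_mult:
  assumes "f \<in> Y a b"
  shows "continuous_on (Omega_bar a b) (\<lambda>r'. exp (- k * of_real (l1norm (r - r'))) * f r')"
  using assms unfolding Y_def l1norm_def by (auto intro!: continuous_intros)

text \<open>
  An identity for \<open>L q\<close> on the open rectangle is enough to compute \<open>K L q\<close>; in particular, it
  transfers the integrability of its other side to \<open>L q\<close>, which may be unbounded a priori.
\<close>

lemma K_op_cong:
  assumes "\<And>r. r \<in> Omega a b \<Longrightarrow> f r = g r"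
  shows "K_op a b k c f = K_op a b k c g"
  unfolding K_op_def
  by (intro ext arg_cong[where f = "(*) c"] set_lebesgue_integral_cong)
     (auto simp: assms Omega_eq_box)

lemma K_op_mult: "K_op a b k c (\<lambda>r. s * f r) r = s * K_op a b k c f r"
proof -
  have "exp (- k * of_real (l1norm (r - r'))) * (s * f r') =
      s * (exp (- k * of_real (l1norm (r - r'))) * f r')" for r'
    by simp
  then show ?thesis
    unfolding K_op_def by (simp only: set_integral_mult_right) simp
qed

lemma K_op_add:
  assumes "f \<in> Y a b" "g \<in> Y a b"
  shows "K_op a b k c (\<lambda>r. f r + g r) r = K_op a b k c f r + K_op a b k c g r"
proof -
  note set_integral_add(2)[OF assms[THEN continuous_on_kernel_mult, THEN set_integrable_Omega]]
  then show ?thesis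
    by (simp only: K_op_def distrib_left)
qed

lemma K_op_eq_integral:
  assumes "f \<in> Y a b"
  shows "K_op a b k c f r =
    c * integral (Omega_bar a b) (\<lambda>r'. exp (- k * of_real (l1norm (r - r'))) * f r')"
  unfolding K_op_def
    set_borel_integral_eq_integral(2)[OF set_integrable_Omega[OF continuous_on_kernel_mult[OF assms]]]
  by (simp add: Omega_eq_box Omega_bar_eq_cbox integral_open_interval)

lemma continuous_on_K_op:
  assumes "f \<in> Y a b"
  shows "continuous_on A (K_op a b k c f)"
proof -
  have f: "continuous_on (A \<times> Omega_bar a b) (\<lambda>p. f (snd p))"
    by (rule continuous_on_Y_compose[OF assms]) (auto intro!: continuous_intros)
  have "continuous_on (A \<times> Omega_bar a b)
      (\<lambda>(r, r'). exp (- k * of_real (l1norm (r - r'))) * f r')"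
    unfolding split_beta l1norm_def by (intro continuous_on_mult f) (intro continuous_intros)
  then show ?thesis
    unfolding K_op_eq_integral[OF assms, abs_def] Omega_bar_eq_cbox
    by (intro continuous_intros integral_continuous_on_param)
qed

lemma continuous_on_exp_conv_param:
  assumes "f \<in> Y a b"
  shows "continuous_on {-b..b} (\<lambda>t. exp_conv k (-a) a (\<lambda>s. f (s, t)) x)"
proof -
  have f: "continuous_on ({-b..b} \<times> {-a..a}) (\<lambda>p. f (snd p, fst p))"
    by (rule continuous_on_Y_compose[OF assms])
       (auto simp: Omega_bar_def intro!: continuous_intros)
  have "continuous_on ({-b..b} \<times> {-a..a}) (\<lambda>(t, s). exp (- k * of_real \<bar>x - s\<bar>) * f (s, t))"
    unfolding split_beta by (intro continuous_on_mult f) (intro continuous_intros)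
  then show ?thesis
    unfolding exp_conv_def cbox_interval[symmetric]
    by (intro integral_continuous_on_param)
qed

text \<open>Fubini: \<open>l1norm\<close> is a sum, so the kernel is a product.\<close>

lemma K_op_eq_exp_conv:
  assumes f: "f \<in> Y a b"
  shows "K_op a b k c f r =
    c * exp_conv k (-b) b (\<lambda>t. exp_conv k (-a) a (\<lambda>s. f (s, t)) (fst r)) (snd r)"
proof -
  let ?e = "\<lambda>y t. exp (- k * of_real \<bar>y - t\<bar>)"
  have cont: "continuous_on (cbox (-a, -b) (a, b))
      (\<lambda>r'. exp (- k * of_real (l1norm (r - r'))) * f r')"
    using continuous_on_kernel_mult[OF f] by (simp add: Omega_bar_eq_cbox)
  have ker: "exp (- k * of_real (l1norm (r - (s, t)))) * f (s, t) =
      ?e (snd r) t * (?e (fst r) s * f (s, t))" for s t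
    by (simp add: l1norm_def algebra_simps flip: exp_add mult.assoc)
  have "integral (Omega_bar a b) (\<lambda>r'. exp (- k * of_real (l1norm (r - r'))) * f r') =
      integral (cbox (-a) a) (\<lambda>s. integral (cbox (-b) b)
        (\<lambda>t. exp (- k * of_real (l1norm (r - (s, t)))) * f (s, t)))"
    unfolding Omega_bar_eq_cbox by (rule integral_prod_continuous[OF cont])
  also have "\<dots> = integral (cbox (-b) b) (\<lambda>t. integral (cbox (-a) a)
        (\<lambda>s. exp (- k * of_real (l1norm (r - (s, t)))) * f (s, t)))"
    by (rule integral_swap_continuous) (use cont in \<open>simp add: split_beta\<close>)
  also have "\<dots> = exp_conv k (-b) b (\<lambda>t. exp_conv k (-a) a (\<lambda>s. f (s, t)) (fst r)) (snd r)"
    unfolding ker exp_conv_def by simp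
  finally show ?thesis
    by (simp add: K_op_eq_integral[OF f])
qed

text \<open>
  With \<open>F\<close> the convolution in \<open>x\<close> alone, \<open>K f\<close> is the convolution of \<open>c F\<close> in \<open>y\<close>.  The factor
  \<open>k\<^sup>2 - \<partial>\<^sup>2/\<partial>y\<^sup>2\<close> turns it into \<open>2 k c F\<close>, and \<open>k\<^sup>2 - \<partial>\<^sup>2/\<partial>x\<^sup>2\<close> turns that into \<open>4 k\<^sup>2 c f\<close>.
\<close>

lemma has_L_on_K_op:
  assumes f: "f \<in> Y a b"
  shows "has_L_on k (K_op a b k c f) (\<lambda>r. 4 * c * k\<^sup>2 * f r) (Omega a b)"
proof -
  define F where "F = (\<lambda>r. exp_conv k (-a) a (\<lambda>s. f (s, snd r)) (fst r))"
  define G where "G = (\<lambda>r. exp_conv k (-b) b (\<lambda>t. F (fst r, t)) (snd r))"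
  define G1 where "G1 = (\<lambda>r. exp_conv_deriv k (-b) b (\<lambda>t. F (fst r, t)) (snd r))"
  define F1 where "F1 = (\<lambda>r. exp_conv_deriv k (-a) a (\<lambda>s. f (s, snd r)) (fst r))"
  have K: "K_op a b k c f = (\<lambda>r. c * G r)"
    by (simp add: fun_eq_iff K_op_eq_exp_conv[OF f] G_def F_def)
  have contF: "continuous_on {-b..b} (\<lambda>t. F (x, t))" for x
    using continuous_on_exp_conv_param[OF f] by (simp add: F_def)
  have contf: "continuous_on {-a..a} (\<lambda>s. f (s, y))" if "y \<in> {-b<..<b}" for y
    by (rule continuous_on_Y_compose[OF f])
       (use that in \<open>auto simp: Omega_bar_def intro!: continuous_intros\<close>)
  have "has_dy_on (\<lambda>r. c * G r) (\<lambda>r. c * G1 r) (Omega a b)"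
    unfolding has_dy_on_def G_def G1_def
    by (auto intro!: has_vector_derivative_mult_right exp_conv_has_deriv contF simp: Omega_def)
  moreover have "has_dy_on (\<lambda>r. c * G1 r) (\<lambda>r. c * (k\<^sup>2 * G r - 2 * k * F r)) (Omega a b)"
    unfolding has_dy_on_def
  proof clarify
    fix x y assume "(x, y) \<in> Omega a b"
    then have "(exp_conv_deriv k (-b) b (\<lambda>t. F (x, t)) has_vector_derivative
        k\<^sup>2 * exp_conv k (-b) b (\<lambda>t. F (x, t)) y - 2 * k * F (x, y)) (at y)"
      by (intro exp_conv_deriv_has_deriv contF) (simp add: Omega_def)
    then show "((\<lambda>t. c * G1 (fst (x, y), t)) has_vector_derivative
        c * (k\<^sup>2 * G (x, y) - 2 * k * F (x, y))) (at (snd (x, y)))"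
      by (auto intro!: has_vector_derivative_mult_right simp: G1_def G_def)
  qed
  moreover have "(\<lambda>r. 2 * k * c * F r) =
      (\<lambda>r. k\<^sup>2 * (c * G r) - c * (k\<^sup>2 * G r - 2 * k * F r))"
    by (simp add: algebra_simps)
  moreover have "has_dx_on (\<lambda>r. 2 * k * c * F r) (\<lambda>r. 2 * k * c * F1 r) (Omega a b)"
    unfolding has_dx_on_def F_def F1_def
    by (auto intro!: has_vector_derivative_mult_right exp_conv_has_deriv contf simp: Omega_def)
  moreover have "has_dx_on (\<lambda>r. 2 * k * c * F1 r)
      (\<lambda>r. 2 * k * c * (k\<^sup>2 * F r - 2 * k * f r)) (Omega a b)"
    unfolding has_dx_on_def
  proof clarify
    fix x y assume "(x, y) \<in> Omega a b"
    then have "(exp_conv_deriv k (-a) a (\<lambda>s. f (s, y)) has_vector_derivative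
        k\<^sup>2 * exp_conv k (-a) a (\<lambda>s. f (s, y)) x - 2 * k * f (x, y)) (at x)"
      by (intro exp_conv_deriv_has_deriv contf) (simp_all add: Omega_def)
    then show "((\<lambda>t. 2 * k * c * F1 (t, snd (x, y))) has_vector_derivative
        2 * k * c * (k\<^sup>2 * F (x, y) - 2 * k * f (x, y))) (at (fst (x, y)))"
      by (auto intro!: has_vector_derivative_mult_right simp: F1_def F_def)
  qed
  moreover have "\<forall>r\<in>Omega a b. 4 * c * k\<^sup>2 * f r =
      k\<^sup>2 * (2 * k * c * F r) - 2 * k * c * (k\<^sup>2 * F r - 2 * k * f r)"
    by (simp add: algebra_simps power2_eq_square)
  ultimately show ?thesis
    unfolding K by (rule has_L_onI)
qed

lemma L_op_K_op:
  assumes "f \<in> Y a b" "r \<in> Omega a b"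
  shows "L_op k (K_op a b k c f) r = 4 * c * k\<^sup>2 * f r"
  by (rule has_L_on_L_op_eq[OF open_Omega has_L_on_K_op]) (fact assms)+

section \<open>Equivalence of the integral and the differential equation\<close>

text \<open>
  On the open rectangle, \<open>L\<close> passes from the first identity to the second and \<open>K\<close> passes from the
  second to \<open>m K L q = 4 c k\<^sup>2 K u\<close>.  Against this, commutation of \<open>K\<close> and \<open>L\<close> on \<open>q\<close> says
  exactly that \<open>m q = K u\<close>.  Only the last step of the converse looks at the boundary.
\<close>

lemma K_op_eq_iff:
  assumes ab: "a > 0" "b > 0" and q: "q \<in> Y a b" "mixed_smooth_on q (Omega a b)"
    and u: "u \<in> Y a b" and nz: "m \<noteq> 0" "c \<noteq> 0" "k \<noteq> 0"
  shows "(\<forall>r\<in>Omega_bar a b. m * q r = K_op a b k c u r) \<longleftrightarrow>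
    (\<forall>r\<in>Omega a b. m * L_op k q r = 4 * c * k\<^sup>2 * u r) \<and>
    (\<forall>r\<in>Omega a b. K_op a b k c (L_op k q) r = L_op k (K_op a b k c q) r)"
    (is "?I \<longleftrightarrow> ?D \<and> ?C")
proof -
  let ?K = "K_op a b k c" and ?L = "L_op k"
  have KL: "m * ?K (?L q) r = 4 * c * k\<^sup>2 * ?K u r" if ?D for r
  proof -
    have "?K (\<lambda>r. m * ?L q r) = ?K (\<lambda>r. 4 * c * k\<^sup>2 * u r)"
      by (rule K_op_cong) (use that in blast)
    then show ?thesis
      by (metis K_op_mult)
  qed
  show ?thesis
  proof (intro iffI conjI)
    assume I: ?I
    \<comment> \<open>A combination with second coefficient \<open>0\<close> serves as multiplication by a scalar.\<close>
    have mL: "has_L_on k (\<lambda>r. m * q r) (\<lambda>r. m * ?L q r) (Omega a b)"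
      using has_L_on_lincomb[OF has_L_on_L_op[OF open_Omega q(2)] has_L_on_L_op[OF open_Omega q(2)],
          of k m 0] by simp
    have "has_L_on k (?K u) (\<lambda>r. m * ?L q r) (Omega a b)"
      by (rule has_L_on_cong[OF open_Omega mL]) (use I Omega_subset in auto)
    then show D: ?D
      using has_L_on_L_op_eq[OF open_Omega] L_op_K_op[OF u] by metis
    show ?C
    proof
      fix r assume r: "r \<in> Omega a b"
      then have "m * ?K (?L q) r = m * (4 * c * k\<^sup>2 * q r)"
        using KL[OF D, of r] I Omega_subset by (metis mult.left_commute subsetD)
      then show "?K (?L q) r = ?L (?K q) r"
        using nz r by (simp add: L_op_K_op[OF q(1)])
    qed
  next
    assume DC: "?D \<and> ?C"
    have "m * q r - ?K u r = 0" if r: "r \<in> Omega a b" for r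
    proof -
      have "4 * c * k\<^sup>2 * ?K u r = m * (4 * c * k\<^sup>2 * q r)"
        using KL[of r] DC r L_op_K_op[OF q(1)] by metis
      then have "4 * c * k\<^sup>2 * (m * q r - ?K u r) = 0"
        by (simp only: right_diff_distrib) (simp add: mult.left_commute)
      then show ?thesis
        using nz by auto
    qed
    moreover have "continuous_on (closure (Omega a b)) (\<lambda>r. m * q r - ?K u r)"
      using q(1) by (auto simp: closure_Omega[OF ab] Y_def intro!: continuous_intros
          continuous_on_K_op[OF u])
    ultimately have "m * q r - ?K u r = 0" if "r \<in> Omega_bar a b" for r
      using continuous_constant_on_closure[of "Omega a b" "\<lambda>r. m * q r - ?K u r" 0 r] that
      by (simp add: closure_Omega[OF ab])
    then show ?I
      by simp
  qed
qed

lemma L_op_Delta_op: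
  assumes q: "q \<in> Y a b" "mixed_smooth_on q (Omega a b)" and r: "r \<in> Omega a b"
  shows "L_op k (Delta_op a b k c \<alpha> z q) r = (z + of_real \<alpha>) * L_op k q r - 4 * c * k\<^sup>2 * q r"
proof -
  have "has_L_on k (\<lambda>r. (z + of_real \<alpha>) * q r - 1 * K_op a b k c q r)
      (\<lambda>r. (z + of_real \<alpha>) * L_op k q r - 1 * (4 * c * k\<^sup>2 * q r)) (Omega a b)"
    by (intro has_L_on_lincomb has_L_on_L_op has_L_on_K_op open_Omega q)
  from has_L_on_L_op_eq[OF open_Omega this r] show ?thesis
    by (simp add: Delta_op_def[abs_def])
qed

text \<open>This is \<open>K_op_eq_iff\<close> for \<open>u = g + q\<close>, with \<open>K q\<close> moved to the other side.\<close>

lemma Delta_op_eq_K_op_iff: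
  assumes ab: "a > 0" "b > 0" and q: "q \<in> Y a b" "mixed_smooth_on q (Omega a b)"
    and g: "g \<in> Y a b" and nz: "z \<noteq> - of_real \<alpha>" "c \<noteq> 0" "k \<noteq> 0"
  shows "(\<forall>r\<in>Omega_bar a b. Delta_op a b k c \<alpha> z q r = K_op a b k c g r) \<longleftrightarrow>
    (\<forall>r\<in>Omega a b. L_op k (Delta_op a b k c \<alpha> z q) r = 4 * c * k\<^sup>2 * g r) \<and>
    (\<forall>r\<in>Omega a b. K_op a b k c (L_op k q) r = L_op k (K_op a b k c q) r)"
proof -
  define m where "m = z + of_real \<alpha>"
  have m: "m \<noteq> 0"
    using nz(1) by (simp only: m_def eq_neg_iff_add_eq_0 not_False_eq_True)
  have u: "(\<lambda>r. g r + q r) \<in> Y a b"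
    using q(1) g by (auto simp: Y_def intro!: continuous_intros)
  have "Delta_op a b k c \<alpha> z q r = K_op a b k c g r \<longleftrightarrow>
      m * q r = K_op a b k c (\<lambda>r. g r + q r) r" for r
    by (simp only: Delta_op_def m_def K_op_add[OF g q(1)] diff_eq_eq)
  moreover have "L_op k (Delta_op a b k c \<alpha> z q) r = 4 * c * k\<^sup>2 * g r \<longleftrightarrow>
      m * L_op k q r = 4 * c * k\<^sup>2 * (g r + q r)" if "r \<in> Omega a b" for r
    by (simp only: L_op_Delta_op[OF q that] m_def distrib_left diff_eq_eq)
  ultimately show ?thesis
    using K_op_eq_iff[OF ab q u m nz(2,3)] by simp
qed

theorem theorem4p1:
  fixes a b \<alpha> \<tau>0 S1 :: real
    and chat \<xi> z :: complex
    and q :: "real \<times> real \<Rightarrow> complex"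
  defines "k \<equiv> k_coeff \<xi> z"
    and "c \<equiv> c_coeff chat S1 \<tau>0 z"
  defines "K \<equiv> K_op a b k c"
    and "\<Delta> \<equiv> Delta_op a b k c \<alpha> z"
    and "L \<equiv> L_op k"
  assumes "a > 0" and "b > 0" and "\<alpha> > 0" and "\<tau>0 > 0" and "S1 \<noteq> 0" and "chat \<noteq> 0"
    and "\<forall>r\<in>Omega_bar a b. \<forall>r'\<in>Omega_bar a b. J chat \<xi> r r' \<in> \<real>"
    and "q \<in> Y a b"
    and "mixed_smooth_on q (Omega a b)"
    and "z \<noteq> - complex_of_real \<alpha>"
    and "k \<noteq> 0"
  shows "((\<forall>r\<in>Omega_bar a b. \<Delta> q r = 0) \<longleftrightarrow>
            (\<forall>r\<in>Omega a b. L (\<Delta> q) r = 0) \<and>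
            (\<forall>r\<in>Omega a b. K (L q) r = L (K q) r)) \<and>
         (\<forall>g\<in>Y a b.
            (\<forall>r\<in>Omega_bar a b. \<Delta> q r = K g r) \<longleftrightarrow>
              (\<forall>r\<in>Omega a b. L (\<Delta> q) r = 4 * c * k\<^sup>2 * g r) \<and>
              (\<forall>r\<in>Omega a b. K (L q) r = L (K q) r))"
proof -
  have "c \<noteq> 0"
    using \<open>chat \<noteq> 0\<close> \<open>S1 \<noteq> 0\<close> by (simp add: c_def c_coeff_def)
  then have *: "(\<forall>r\<in>Omega_bar a b. \<Delta> q r = K g r) \<longleftrightarrow>
      (\<forall>r\<in>Omega a b. L (\<Delta> q) r = 4 * c * k\<^sup>2 * g r) \<and>
      (\<forall>r\<in>Omega a b. K (L q) r = L (K q) r)" if "g \<in> Y a b" for g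
    unfolding K_def \<Delta>_def L_def
    using \<open>a > 0\<close> \<open>b > 0\<close> \<open>q \<in> Y a b\<close> \<open>mixed_smooth_on q (Omega a b)\<close> that
      \<open>z \<noteq> - complex_of_real \<alpha>\<close> \<open>k \<noteq> 0\<close>
    by (intro Delta_op_eq_K_op_iff)
  have "K (\<lambda>_. 0) r = 0" for r
    by (simp add: K_def K_op_def)
  moreover have "(\<lambda>_. 0) \<in> Y a b"
    by (simp add: Y_def)
  ultimately show ?thesis
    using * *[of "\<lambda>_. 0"] by simp
qed

end
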